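(* Let $X$ be a set and let $\mathcal G$ be a complete submodule of $\overline{\mathbb R}^X_{\max}$. The following properties are equivalent: (i) there exist two kernels $a,b:X\times X\to\overline{\mathbb R}$ such that, with the weighted sup-inner product $(f,g)_{\sup,a}=\sup_{y,z\in X} f(y)+_\bot g(z)+_\bot a(y,z)$, one has for all $x\in X$ and $f\in\mathcal G$ $$f(x)=(f,b(x,\cdot))_{\sup,a}\quad\text{and}\quad b(\cdot,x)\in\mathcal G;$$ (ii) $\mathcal G=\mathrm{Rg}(P)$ for some linear continuous idempotent operator $P:\overline{\mathbb R}^X_{\max}\to\overline{\mathbb R}^X_{\max}$, i.e. $P=P^2$; (iii) $\mathcal G=\mathrm{Rg}(B)$ for some von Neumann regular operator $B:\overline{\mathbb R}^X_{\max}\to\overline{\mathbb R}^X_{\max}$, i.e. a linear and continuous operator such that there exists a linear continuous $A:\overline{\mathbb R}^X_{\max}\to\overline{\mathbb R}^X_{\max}$ satisfying $B=BAB$.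
   Context: $\overline{\mathbb R}=[-\infty,+\infty]$, and $+_\bot$ extends addition to $\overline{\mathbb R}$ with $-\infty$ absorbing. $\overline{\mathbb R}^X_{\max}$ is the set of functions $X\to\overline{\mathbb R}$ with the pointwise $(\max,+)$ operations and the pointwise order. A subset $\mathcal G\subset\overline{\mathbb R}^X$ is a complete submodule if it is stable under arbitrary pointwise suprema (including the empty one) and under addition of constants $f\mapsto f+\lambda$, $\lambda\in\mathbb R$. A map $B:\overline{\mathbb R}^X_{\max}\to\overline{\mathbb R}^X_{\max}$ is linear and continuous if $B(\sup_{i\in I} f_i)=\sup_{i\in I} Bf_i$ for all (possibly infinite) families and $B(f+_\bot\lambda)=Bf+_\bot\lambda$ for all $f$ and all $\lambda\in\overline{\mathbb R}$; equivalently, there is a kernel $b:X\times X\to\overline{\mathbb R}$ with $Bf(x)=\sup_{y\in X}b(x,y)+_\bot f(y)$ for all $f,x$. The range is $\mathrm{Rg}(B)=\{Bf: f\in\overline{\mathbb R}^X\}$; products of operators are compositions. *)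

theory Defs
  imports "HOL-Library.FuncSet" "HOL-Library.Extended_Real"
begin

text \<open>
  The library addition on \<^typ>\<open>ereal\<close> satisfies \<open>\<infinity> + -\<infinity> = \<infinity>\<close>; the max-plus convention needs
  \<open>-\<infinity>\<close> to be absorbing, hence a separate operation.
\<close>

definition plus_bot :: "ereal \<Rightarrow> ereal \<Rightarrow> ereal"  (infixl \<open>+\<^sub>\<bottom>\<close> 65)
  where "a +\<^sub>\<bottom> b = (if a = -\<infinity> \<or> b = -\<infinity> then -\<infinity> else a + b)"

text \<open>
  The base set is an arbitrary, possibly empty, set \<open>X\<close>. Functions on \<open>X\<close> are represented by
  extensional functions, so that equality of functions is equality on \<open>X\<close>.
\<close>

abbreviation fun_space :: "'a set \<Rightarrow> ('a \<Rightarrow> ereal) set"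
  where "fun_space X \<equiv> X \<rightarrow>\<^sub>E UNIV"

definition psup :: "'a set \<Rightarrow> ('a \<Rightarrow> ereal) set \<Rightarrow> 'a \<Rightarrow> ereal"
  where "psup X F = (\<lambda>x\<in>X. SUP f\<in>F. f x)"

definition padd :: "'a set \<Rightarrow> ('a \<Rightarrow> ereal) \<Rightarrow> ereal \<Rightarrow> 'a \<Rightarrow> ereal"
  where "padd X f c = (\<lambda>x\<in>X. f x +\<^sub>\<bottom> c)"

text \<open>
  Suprema of families are given by suprema of sets of functions, since the supremum of a family
  depends only on its image. The case \<open>F = {}\<close> is included throughout.
\<close>

definition complete_submodule :: "'a set \<Rightarrow> ('a \<Rightarrow> ereal) set \<Rightarrow> bool"
  where "complete_submodule X G \<longleftrightarrow>
    G \<subseteq> fun_space X \<and>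
    (\<forall>F. F \<subseteq> G \<longrightarrow> psup X F \<in> G) \<and>
    (\<forall>f\<in>G. \<forall>c::real. padd X f (ereal c) \<in> G)"

definition linear_continuous ::
    "'a set \<Rightarrow> (('a \<Rightarrow> ereal) \<Rightarrow> ('a \<Rightarrow> ereal)) \<Rightarrow> bool"
  where "linear_continuous X B \<longleftrightarrow>
    B \<in> fun_space X \<rightarrow> fun_space X \<and>
    (\<forall>F. F \<subseteq> fun_space X \<longrightarrow> B (psup X F) = psup X (B ` F)) \<and>
    (\<forall>f\<in>fun_space X. \<forall>c::ereal. B (padd X f c) = padd X (B f) c)"

definition Rg :: "'a set \<Rightarrow> (('a \<Rightarrow> ereal) \<Rightarrow> ('a \<Rightarrow> ereal)) \<Rightarrow> ('a \<Rightarrow> ereal) set"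
  where "Rg X B = B ` fun_space X"

definition idempotent_op :: "'a set \<Rightarrow> (('a \<Rightarrow> ereal) \<Rightarrow> ('a \<Rightarrow> ereal)) \<Rightarrow> bool"
  where "idempotent_op X P \<longleftrightarrow> (\<forall>f\<in>fun_space X. P (P f) = P f)"

definition von_neumann_regular ::
    "'a set \<Rightarrow> (('a \<Rightarrow> ereal) \<Rightarrow> ('a \<Rightarrow> ereal)) \<Rightarrow> bool"
  where "von_neumann_regular X B \<longleftrightarrow>
    linear_continuous X B \<and>
    (\<exists>A. linear_continuous X A \<and> (\<forall>f\<in>fun_space X. B (A (B f)) = B f))"

text \<open>
  Kernels on \<open>X \<times> X\<close> are curried; only their values on \<open>X \<times> X\<close> are ever used.
\<close>

definition sup_inner ::
    "'a set \<Rightarrow> ('a \<Rightarrow> 'a \<Rightarrow> ereal) \<Rightarrow> ('a \<Rightarrow> ereal) \<Rightarrow> ('a \<Rightarrow> ereal) \<Rightarrow> ereal"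
  where "sup_inner X a f g = (SUP (y, z)\<in>X \<times> X. f y +\<^sub>\<bottom> g z +\<^sub>\<bottom> a y z)"

end

theory Submission
  imports Defs
begin

text \<open>
  The proof rests on the fact that linear continuous operators are exactly the kernel operators
  \<open>f \<mapsto> (x \<mapsto> sup\<^sub>y k x y +\<^sub>\<bottom> f y)\<close>: every function is a supremum of translates of Dirac functions
  (\<open>dirac_decomposition\<close>), so such an operator is determined by its values on them
  (\<open>linear_continuous_imp_kernel\<close>). Since \<open>+\<^sub>\<bottom>\<close> is associative and distributes over arbitrary
  suprema, the inner product with weight \<open>a\<close> of \<open>f\<close> and the row \<open>b(x, \<cdot>)\<close> unfolds to
  \<open>B (A f) x\<close>, where \<open>B\<close> has kernel \<open>b\<close> and \<open>A\<close> has the transpose of \<open>a\<close>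
  as its kernel (\<open>sup_inner_eq_kernel_op\<close>). Thus the reproducing property in (i) says that \<open>BA\<close> is the
  identity on \<open>G\<close>, while the condition that the columns of \<open>b\<close> lie in \<open>G\<close> says that \<open>Rg B \<subseteq> G\<close>.

  With this dictionary the implications are short. If (i) holds, then \<open>BA\<close> maps everything into \<open>G\<close>
  and fixes \<open>G\<close> pointwise, so it is an idempotent with range \<open>G\<close>. An idempotent \<open>P\<close> satisfies
  \<open>P = PPP\<close>, so it is von Neumann regular. If \<open>B = BAB\<close>, then \<open>BA\<close> fixes every element of
  \<open>G = Rg B\<close>, and the columns of the kernel of \<open>B\<close> are the images of the Dirac functions, so the
  kernel of \<open>B\<close> and the transposed kernel of \<open>A\<close> give (i).
\<close>

section \<open>Arithmetic of the bottom-absorbing addition\<close>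

lemma plus_bot_commute: "a +\<^sub>\<bottom> b = b +\<^sub>\<bottom> a"
  by (auto simp: plus_bot_def add.commute)

lemma plus_bot_assoc: "a +\<^sub>\<bottom> b +\<^sub>\<bottom> c = a +\<^sub>\<bottom> (b +\<^sub>\<bottom> c)"
  by (cases a; cases b; cases c) (simp_all add: plus_bot_def)

lemma plus_bot_simps [simp]:
  "a +\<^sub>\<bottom> -\<infinity> = -\<infinity>" "-\<infinity> +\<^sub>\<bottom> a = -\<infinity>" "a +\<^sub>\<bottom> 0 = a" "0 +\<^sub>\<bottom> a = a"
  by (auto simp: plus_bot_def)

text \<open>
  Distributivity over arbitrary suprema, including the empty one, is what the convention
  that \<open>-\<infinity>\<close> absorbs is made for: with \<open>c = \<infinity>\<close>, both sides are \<open>\<infinity>\<close> exactly when some \<open>f i\<close> differs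
  from \<open>-\<infinity>\<close>, and \<open>-\<infinity>\<close> otherwise.
\<close>

lemma SUP_plus_bot: "(SUP i\<in>I. f i) +\<^sub>\<bottom> c = (SUP i\<in>I. f i +\<^sub>\<bottom> c)"
proof (cases "I = {}")
  case True
  then show ?thesis by (simp add: bot_ereal_def)
next
  case False
  show ?thesis
  proof (cases c)
    case (real r)
    have "(SUP i\<in>I. f i + ereal r) = (SUP i\<in>I. f i) + ereal r"
      using False by (intro SUP_ereal_add_left) auto
    moreover have "x +\<^sub>\<bottom> ereal r = x + ereal r" for x
      by (cases x) (auto simp: plus_bot_def)
    ultimately show ?thesis using real by simp
  next
    case PInf
    show ?thesis
    proof (cases "\<forall>i\<in>I. f i = -\<infinity>")
      case True
      then have "(SUP i\<in>I. f i) = -\<infinity>" and "(SUP i\<in>I. f i +\<^sub>\<bottom> c) = -\<infinity>"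
        using False by simp_all
      then show ?thesis by simp
    next
      case non_bot: False
      then obtain i where i: "i \<in> I" "f i \<noteq> -\<infinity>" by auto
      then have "f i \<le> (SUP i\<in>I. f i)" and le: "f i +\<^sub>\<bottom> c \<le> (SUP i\<in>I. f i +\<^sub>\<bottom> c)"
        by (auto intro: SUP_upper)
      then have "(SUP i\<in>I. f i) \<noteq> -\<infinity>" using i by auto
      moreover have "f i +\<^sub>\<bottom> c = \<infinity>" using i PInf by (simp add: plus_bot_def)
      ultimately show ?thesis using PInf le by (simp add: plus_bot_def)
    qed
  next
    case MInf
    then show ?thesis using False by simp
  qed
qed

lemma plus_bot_SUP: "c +\<^sub>\<bottom> (SUP i\<in>I. f i) = (SUP i\<in>I. c +\<^sub>\<bottom> f i)"
  using SUP_plus_bot[of f I c] by (simp add: plus_bot_commute)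

section \<open>Kernel operators\<close>

definition kernel_op ::
    "'a set \<Rightarrow> ('a \<Rightarrow> 'a \<Rightarrow> ereal) \<Rightarrow> ('a \<Rightarrow> ereal) \<Rightarrow> 'a \<Rightarrow> ereal"
  where "kernel_op X k f = (\<lambda>x\<in>X. SUP y\<in>X. k x y +\<^sub>\<bottom> f y)"

lemma kernel_op_in_fun_space: "kernel_op X k f \<in> fun_space X"
  by (simp add: kernel_op_def)

lemma padd_in_fun_space: "padd X f c \<in> fun_space X"
  by (simp add: padd_def)

lemma linear_continuousD:
  assumes "linear_continuous X B"
  shows linear_continuous_maps: "f \<in> fun_space X \<Longrightarrow> B f \<in> fun_space X"
    and linear_continuous_psup: "F \<subseteq> fun_space X \<Longrightarrow> B (psup X F) = psup X (B ` F)"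
    and linear_continuous_padd: "f \<in> fun_space X \<Longrightarrow> B (padd X f c) = padd X (B f) c"
proof -
  note B = assms[unfolded linear_continuous_def]
  show "B f \<in> fun_space X" if "f \<in> fun_space X"
    using conjunct1[OF B] that by (rule funcset_mem)
  show "B (psup X F) = psup X (B ` F)" if "F \<subseteq> fun_space X"
    by (rule mp[OF spec[OF conjunct1[OF conjunct2[OF B]]] that])
  show "B (padd X f c) = padd X (B f) c" if "f \<in> fun_space X"
    by (rule spec[OF bspec[OF conjunct2[OF conjunct2[OF B]] that]])
qed

lemma linear_continuous_kernel_op: "linear_continuous X (kernel_op X k)"
  unfolding linear_continuous_def
proof (intro conjI ballI allI impI)
  show "kernel_op X k \<in> fun_space X \<rightarrow> fun_space X"
    by (rule funcsetI) (rule kernel_op_in_fun_space)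
next
  fix F
  show "kernel_op X k (psup X F) = psup X (kernel_op X k ` F)"
  proof
    fix x
    have "(SUP y\<in>X. SUP f\<in>F. k x y +\<^sub>\<bottom> f y) = (SUP f\<in>F. SUP y\<in>X. k x y +\<^sub>\<bottom> f y)"
      by (rule SUP_commute)
    then show "kernel_op X k (psup X F) x = psup X (kernel_op X k ` F) x"
      by (simp add: kernel_op_def psup_def plus_bot_SUP image_image)
  qed
next
  fix f c
  show "kernel_op X k (padd X f c) = padd X (kernel_op X k f) c"
    by (rule ext) (simp add: kernel_op_def padd_def SUP_plus_bot plus_bot_assoc)
qed

definition dirac :: "'a set \<Rightarrow> 'a \<Rightarrow> 'a \<Rightarrow> ereal"
  where "dirac X y = (\<lambda>x\<in>X. if x = y then 0 else -\<infinity>)"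

lemma dirac_in_fun_space: "dirac X y \<in> fun_space X"
  by (simp add: dirac_def)

lemma dirac_decomposition:
  assumes "f \<in> fun_space X"
  shows "f = psup X ((\<lambda>y. padd X (dirac X y) (f y)) ` X)"
proof
  fix x
  show "f x = psup X ((\<lambda>y. padd X (dirac X y) (f y)) ` X) x"
  proof (cases "x \<in> X")
    case True
    have "(SUP y\<in>X. (if x = y then 0 else -\<infinity>) +\<^sub>\<bottom> f y) = f x"
    proof (rule antisym)
      show "(SUP y\<in>X. (if x = y then 0 else -\<infinity>) +\<^sub>\<bottom> f y) \<le> f x"
        by (rule SUP_least) auto
      show "f x \<le> (SUP y\<in>X. (if x = y then 0 else -\<infinity>) +\<^sub>\<bottom> f y)"
        by (rule SUP_upper2[OF True]) simp
    qed
    with True show ?thesis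
      by (simp add: psup_def padd_def dirac_def image_image)
  next
    case False
    with PiE_arb[OF assms False] show ?thesis by (simp add: psup_def)
  qed
qed

text \<open>
  Column \<open>y\<close> of the kernel is the image of the Dirac function at \<open>y\<close>. Linearity for infinite
  constants matters here, because the coefficients \<open>f y\<close> of the Dirac functions may be infinite.
\<close>

lemma linear_continuous_imp_kernel:
  assumes B: "linear_continuous X B" and f: "f \<in> fun_space X"
  shows "B f = kernel_op X (\<lambda>x y. B (dirac X y) x) f"
proof -
  have "B f = B (psup X ((\<lambda>y. padd X (dirac X y) (f y)) ` X))"
    by (rule arg_cong[OF dirac_decomposition[OF f]])
  also have "\<dots> = psup X (B ` (\<lambda>y. padd X (dirac X y) (f y)) ` X)"
    by (rule linear_continuous_psup[OF B]) (rule image_subsetI, rule padd_in_fun_space)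
  also have "\<dots> = psup X ((\<lambda>y. padd X (B (dirac X y)) (f y)) ` X)"
    by (simp only: image_image linear_continuous_padd[OF B dirac_in_fun_space])
  also have "\<dots> = kernel_op X (\<lambda>x y. B (dirac X y) x) f"
    by (rule ext) (simp add: psup_def padd_def kernel_op_def image_image)
  finally show ?thesis .
qed

lemma linear_continuous_compose:
  assumes B: "linear_continuous X B" and A: "linear_continuous X A"
  shows "linear_continuous X (\<lambda>f. B (A f))"
  unfolding linear_continuous_def
proof (intro conjI ballI allI impI)
  show "(\<lambda>f. B (A f)) \<in> fun_space X \<rightarrow> fun_space X"
    by (rule funcsetI) (intro linear_continuous_maps[OF B] linear_continuous_maps[OF A])
  show "B (A (psup X F)) = psup X ((\<lambda>f. B (A f)) ` F)" if F: "F \<subseteq> fun_space X" for F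
  proof -
    have "A ` F \<subseteq> fun_space X"
      using F linear_continuous_maps[OF A] by (meson image_subsetI subsetD)
    then have "B (psup X (A ` F)) = psup X (B ` A ` F)"
      by (rule linear_continuous_psup[OF B])
    then show ?thesis by (simp only: image_image linear_continuous_psup[OF A F])
  qed
  show "B (A (padd X f c)) = padd X (B (A f)) c" if f: "f \<in> fun_space X" for f c
    by (simp only: linear_continuous_padd[OF A f]
        linear_continuous_padd[OF B linear_continuous_maps[OF A f]])
qed

text \<open>
  The inner product pairs \<open>f\<close> with the first argument of \<open>a\<close>, whereas an operator pairs its
  argument with the second argument of its kernel; hence the transpose.
\<close>

lemma sup_inner_eq_kernel_op:
  assumes "x \<in> X"
  shows "sup_inner X a f (\<lambda>z\<in>X. b x z) = kernel_op X b (kernel_op X (\<lambda>z y. a y z) f) x"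
proof -
  have "sup_inner X a f (\<lambda>z\<in>X. b x z) = (SUP y\<in>X. SUP z\<in>X. f y +\<^sub>\<bottom> b x z +\<^sub>\<bottom> a y z)"
    unfolding sup_inner_def SUP_pair by (rule SUP_cong) (auto simp: mem_Times_iff)
  also have "\<dots> = (SUP z\<in>X. SUP y\<in>X. f y +\<^sub>\<bottom> b x z +\<^sub>\<bottom> a y z)"
    by (rule SUP_commute)
  also have "\<dots> = (SUP z\<in>X. SUP y\<in>X. b x z +\<^sub>\<bottom> (a y z +\<^sub>\<bottom> f y))"
  proof -
    have "f y +\<^sub>\<bottom> b x z +\<^sub>\<bottom> a y z = b x z +\<^sub>\<bottom> (a y z +\<^sub>\<bottom> f y)" for y z
      by (cases "f y"; cases "b x z"; cases "a y z") (simp_all add: plus_bot_def)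
    then show ?thesis by simp
  qed
  finally show ?thesis
    using assms by (simp add: kernel_op_def plus_bot_SUP)
qed

section \<open>Translation and kernel operators in complete submodules\<close>

text \<open>
  Stability under real constants extends to \<open>\<plusminus>\<infinity>\<close>, because every extended real \<open>c\<close> is the supremum of
  the reals below it; for \<open>c = -\<infinity>\<close> this is the empty supremum.
\<close>

lemma complete_submodule_padd:
  assumes G: "complete_submodule X G" and f: "f \<in> G"
  shows "padd X f c \<in> G"
proof -
  define R where "R = {r. ereal r \<le> c}"
  have c: "(SUP r\<in>R. ereal r) = c"
  proof (rule antisym)
    show "(SUP r\<in>R. ereal r) \<le> c"
      by (rule SUP_least) (simp add: R_def)
    show "c \<le> (SUP r\<in>R. ereal r)"
    proof (rule ereal_le_real)
      show "c \<le> ereal s" if "(SUP r\<in>R. ereal r) \<le> ereal s" for s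
      proof (rule ccontr)
        assume "\<not> c \<le> ereal s"
        then have "ereal s < c" by (simp add: not_le)
        from ereal_dense2[OF this] obtain t where t: "ereal s < ereal t" "ereal t < c"
          by blast
        from t(2) have "ereal t \<le> (SUP r\<in>R. ereal r)"
          by (intro SUP_upper) (simp add: R_def)
        also note that
        finally show False using t(1) by simp
      qed
    qed
  qed
  have "padd X f c = psup X ((\<lambda>r. padd X f (ereal r)) ` R)"
    by (rule ext) (simp add: padd_def psup_def image_image plus_bot_SUP[symmetric] c)
  moreover have "(\<lambda>r. padd X f (ereal r)) ` R \<subseteq> G"
    using G f unfolding complete_submodule_def by blast
  ultimately show ?thesis
    using G unfolding complete_submodule_def by simp
qed

text \<open>
  The image of \<open>g\<close> is the max-plus combination of the columns of \<open>b\<close> with the possibly infinite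
  coefficients \<open>g y\<close>.
\<close>

lemma kernel_op_in_complete_submodule:
  assumes G: "complete_submodule X G" and b: "\<And>y. y \<in> X \<Longrightarrow> (\<lambda>x\<in>X. b x y) \<in> G"
  shows "kernel_op X b g \<in> G"
proof -
  have "kernel_op X b g = psup X ((\<lambda>y. padd X (\<lambda>x\<in>X. b x y) (g y)) ` X)"
    by (rule ext) (simp add: kernel_op_def psup_def padd_def image_image)
  moreover have "(\<lambda>y. padd X (\<lambda>x\<in>X. b x y) (g y)) ` X \<subseteq> G"
    using complete_submodule_padd[OF G] b by blast
  ultimately show ?thesis
    using G unfolding complete_submodule_def by simp
qed

section \<open>Reproducing kernels and idempotents\<close>

lemma reproducing_kernel_imp_idempotent:
  assumes G: "complete_submodule X G"
    and repr: "\<And>x f. x \<in> X \<Longrightarrow> f \<in> G \<Longrightarrow> f x = sup_inner X a f (\<lambda>z\<in>X. b x z)"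
    and col: "\<And>x. x \<in> X \<Longrightarrow> (\<lambda>y\<in>X. b y x) \<in> G"
  shows "\<exists>P. linear_continuous X P \<and> idempotent_op X P \<and> G = Rg X P"
proof -
  define P where "P = (\<lambda>f. kernel_op X b (kernel_op X (\<lambda>z y. a y z) f))"
  have P_in: "P f \<in> G" for f
    unfolding P_def using G col by (rule kernel_op_in_complete_submodule)
  have G_sub: "G \<subseteq> fun_space X"
    using G by (simp add: complete_submodule_def)
  have P_fix: "P f = f" if f: "f \<in> G" for f
  proof (rule PiE_ext[where k = X and s = "\<lambda>_. UNIV"])
    show "P f \<in> fun_space X" using G_sub P_in by (rule subsetD)
    show "f \<in> fun_space X" using G_sub f by (rule subsetD)
    show "P f x = f x" if "x \<in> X" for x
      using repr[OF that f] sup_inner_eq_kernel_op[OF that, of a f b] by (simp add: P_def)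
  qed
  have "linear_continuous X P"
    unfolding P_def
    by (rule linear_continuous_compose[OF linear_continuous_kernel_op linear_continuous_kernel_op])
  moreover have "idempotent_op X P"
    unfolding idempotent_op_def using P_fix[OF P_in] by blast
  moreover have "G = Rg X P"
    unfolding Rg_def
  proof (intro equalityI subsetI)
    show "f \<in> P ` fun_space X" if "f \<in> G" for f
      using P_fix[OF that, symmetric] subsetD[OF G_sub that] by (rule image_eqI)
    show "f \<in> G" if "f \<in> P ` fun_space X" for f
      using that by (rule imageE) (simp only: P_in)
  qed
  ultimately show ?thesis by blast
qed

lemma idempotent_imp_von_neumann_regular:
  assumes "linear_continuous X P" and "idempotent_op X P"
  shows "von_neumann_regular X P"
proof -
  have "P (P (P f)) = P f" if f: "f \<in> fun_space X" for f
    using assms(2) linear_continuous_maps[OF assms(1) f] f by (simp only: idempotent_op_def)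
  then show ?thesis
    unfolding von_neumann_regular_def using assms(1) by blast
qed

lemma von_neumann_regular_imp_reproducing_kernel:
  assumes "von_neumann_regular X B"
  shows "\<exists>a b. (\<forall>x\<in>X. \<forall>f\<in>Rg X B. f x = sup_inner X a f (\<lambda>z\<in>X. b x z)) \<and>
    (\<forall>x\<in>X. (\<lambda>y\<in>X. b y x) \<in> Rg X B)"
proof -
  obtain A where B: "linear_continuous X B" and A: "linear_continuous X A"
    and BAB: "\<And>f. f \<in> fun_space X \<Longrightarrow> B (A (B f)) = B f"
    using assms unfolding von_neumann_regular_def by blast
  note A_maps = linear_continuous_maps[OF A] and B_maps = linear_continuous_maps[OF B]
  define a where "a = (\<lambda>y z. A (dirac X y) z)"
  define b where "b = (\<lambda>x y. B (dirac X y) x)"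
  have "f x = sup_inner X a f (\<lambda>z\<in>X. b x z)" if x: "x \<in> X" and f: "f \<in> Rg X B" for x f
  proof -
    from f have f_in: "f \<in> fun_space X" and BA: "B (A f) = f"
      using B_maps BAB by (auto simp: Rg_def)
    have "f = kernel_op X b (A f)"
      using linear_continuous_imp_kernel[OF B A_maps[OF f_in]] BA by (simp add: b_def)
    also have "A f = kernel_op X (\<lambda>z y. a y z) f"
      using linear_continuous_imp_kernel[OF A f_in] by (simp add: a_def)
    finally have "f x = kernel_op X b (kernel_op X (\<lambda>z y. a y z) f) x"
      by (rule fun_cong)
    then show ?thesis
      by (rule trans) (rule sup_inner_eq_kernel_op[OF x, symmetric])
  qed
  moreover have "(\<lambda>y\<in>X. b y x) \<in> Rg X B" for x
  proof -
    have "(\<lambda>y\<in>X. b y x) = B (dirac X x)"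
      using B_maps[OF dirac_in_fun_space, of x] by (simp add: b_def PiE_restrict)
    then show ?thesis
      unfolding Rg_def using dirac_in_fun_space by (rule image_eqI)
  qed
  ultimately show ?thesis by blast
qed

section \<open>The equivalence\<close>

theorem theorem6p3:
  fixes X :: "'a set" and G :: "('a \<Rightarrow> ereal) set"
  assumes "complete_submodule X G"
  shows
    "((\<exists>a b :: 'a \<Rightarrow> 'a \<Rightarrow> ereal.
        (\<forall>x\<in>X. \<forall>f\<in>G. f x = sup_inner X a f (\<lambda>z\<in>X. b x z)) \<and>
        (\<forall>x\<in>X. (\<lambda>y\<in>X. b y x) \<in> G))
      \<longleftrightarrow>
      (\<exists>P. linear_continuous X P \<and> idempotent_op X P \<and> G = Rg X P))
     \<and>
     ((\<exists>P. linear_continuous X P \<and> idempotent_op X P \<and> G = Rg X P)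
      \<longleftrightarrow>
      (\<exists>B. von_neumann_regular X B \<and> G = Rg X B))"
    (is "(?i \<longleftrightarrow> ?ii) \<and> (?ii \<longleftrightarrow> ?iii)")
proof -
  have "?i \<Longrightarrow> ?ii"
    using reproducing_kernel_imp_idempotent[OF assms] by blast
  moreover have "?ii \<Longrightarrow> ?iii"
    using idempotent_imp_von_neumann_regular by blast
  moreover have "?iii \<Longrightarrow> ?i"
    using von_neumann_regular_imp_reproducing_kernel by blast
  ultimately show ?thesis by argo
qed

end
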